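(* Let $\mathcal L_f$ be a finitely generated propositional language with normal atoms $b_1,\dots,b_m$, and let $C$ be a regular Popper function on $\mathcal L_f$. Define $a_0$ to be $b_1\vee\dots\vee b_m$, and recursively, as long as there is some normal atom $b_i$ entailing $a_k$ with $C(b_i,a_k)=0$, let $a_{k+1}$ be the disjunction of all normal atoms $b_i$ that entail $a_k$ and satisfy $C(b_i,a_k)=0$. For each $i$ let $\mathrm{rk}(b_i)$ be the least $k$ with $C(b_i,a_k)>0$. Let $\Omega=\mathbb N$, partitioned into $m$ pairwise disjoint infinite sets $\bar b_1,\dots,\bar b_m$; interpret each sentence $a$ of $\mathcal L_f$ by $\bar a=\bigcup\{\bar b_i: b_i \text{ occurs in the disjunction of normal atoms equivalent to } a\}$ (contradictions by $\emptyset$). Let $w(x)=C(b_i,a_{\mathrm{rk}(b_i)})$ for $x\in\bar b_i$. Let $\Lambda$ be the set of finite $\lambda\subseteq\Omega$ such that for all $i,j\le m$: (i) if $\mathrm{rk}(b_i)=\mathrm{rk}(b_j)$ then $|\bar b_i\cap\lambda|=|\bar b_j\cap\lambda|$, and (ii) if $\mathrm{rk}(b_i)<\mathrm{rk}(b_j)$ then $|\bar b_i\cap\lambda|>|\bar b_j\cap\lambda|^2$. Let $\mathcal U$ be any free fine ultrafilter on $\Lambda$ and $P$ the resulting NAP function. Then for all $a,b\in\mathcal L_f$ with $b$ not a contradiction, $$C(a,b)=\mathrm{st}\Big(\frac{P(\bar a\cap\bar b)}{P(\bar b)}\Big).$$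
   Context: A propositional language is finitely generated if it is built by $\neg,\wedge,\vee$ from finitely many atomic propositions. Normal atoms $b_1,\dots,b_m\in\mathcal L_f$: sentences such that $b_i\wedge b_j$ is a contradiction for $i\ne j$, $b_1\vee\dots\vee b_m$ is a tautology, and every non-contradictory sentence is logically equivalent to a disjunction of some of the $b_i$. Popper function: $C:\mathcal L_f\times\mathcal L_f\to[0,1]$ such that for all $a,b,d$: (1) $C(a,a)=1$; (2) if $C(\neg a,a)\ne1$ then $C(\cdot,a)$ is a finitely additive probability function (nonnegative, value $1$ on tautologies, equal on logically equivalent sentences, additive on pairs whose conjunction is contradictory); (3) $C(a\wedge b,d)=C(a,d)\,C(b,a\wedge d)$; (4) if $C(a,b)=C(b,a)=1$ then $C(d,a)=C(d,b)$ for all $d$. $C$ is regular if the only $x$ for which $C(\cdot,x)$ is constantly $1$ are contradictions. Given a free ultrafilter $\mathcal U$ on $\Lambda$ that is fine (for every $x\in\Omega$, $\{\lambda\in\Lambda:x\in\lambda\}\in\mathcal U$), the NAP function is $P(A)=[\lambda\mapsto \sum_{x\in A\cap\lambda}w(x)/\sum_{x\in\lambda}w(x)]_{\mathcal U}\in\mathbb R^{\Lambda}/\mathcal U$, where $\mathbb R^{\Lambda}/\mathcal U$ is the ordered field of functions $\Lambda\to\mathbb R$ modulo agreement on a set in $\mathcal U$. $\mathrm{st}(r)$ denotes the unique real number infinitely close to a finite element $r$ of this field.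
   Formalization: The Popper function is additionally required to satisfy C(a,d)=C(b,d) for logically equivalent a, b for every d, also when C(¬d,d)=1; without this, axioms (1)–(4) and regularity admit syntax-dependent C for which the identity fails. *)

theory Defs
  imports Complex_Main "HOL-Library.Disjoint_Sets"
begin

datatype 'p fm = Atom 'p | Neg "'p fm" | Con "'p fm" "'p fm" | Dis "'p fm" "'p fm"

primrec sat :: "('p \<Rightarrow> bool) \<Rightarrow> 'p fm \<Rightarrow> bool" where
  "sat v (Atom p) \<longleftrightarrow> v p"
| "sat v (Neg x) \<longleftrightarrow> \<not> sat v x"
| "sat v (Con x y) \<longleftrightarrow> sat v x \<and> sat v y"
| "sat v (Dis x y) \<longleftrightarrow> sat v x \<or> sat v y"

definition tautology :: "'p fm \<Rightarrow> bool" where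
  "tautology x \<longleftrightarrow> (\<forall>v. sat v x)"

definition contradiction :: "'p fm \<Rightarrow> bool" where
  "contradiction x \<longleftrightarrow> (\<forall>v. \<not> sat v x)"

definition entails :: "'p fm \<Rightarrow> 'p fm \<Rightarrow> bool" where
  "entails x y \<longleftrightarrow> (\<forall>v. sat v x \<longrightarrow> sat v y)"

definition log_equiv :: "'p fm \<Rightarrow> 'p fm \<Rightarrow> bool" where
  "log_equiv x y \<longleftrightarrow> (\<forall>v. sat v x \<longleftrightarrow> sat v y)"

text \<open>There is no falsum in the language, so only nonempty disjunctions are formed;
  the value on the empty list is left unspecified and never used.\<close>

fun disj_list :: "'p fm list \<Rightarrow> 'p fm" where
  "disj_list [x] = x"
| "disj_list (x # y # zs) = Dis x (disj_list (y # zs))"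

definition Disj :: "(nat \<Rightarrow> 'p fm) \<Rightarrow> nat set \<Rightarrow> 'p fm" where
  "Disj b I = disj_list (map b (sorted_list_of_set I))"

definition normal_atoms :: "nat \<Rightarrow> (nat \<Rightarrow> 'p fm) \<Rightarrow> bool" where
  "normal_atoms m b \<longleftrightarrow>
     1 \<le> m \<and>
     (\<forall>i\<in>{1..m}. \<forall>j\<in>{1..m}. i \<noteq> j \<longrightarrow> contradiction (Con (b i) (b j))) \<and>
     tautology (Disj b {1..m}) \<and>
     (\<forall>x. \<not> contradiction x \<longrightarrow> (\<exists>I\<subseteq>{1..m}. I \<noteq> {} \<and> log_equiv x (Disj b I)))"

definition prob_function :: "('p fm \<Rightarrow> real) \<Rightarrow> bool" where
  "prob_function p \<longleftrightarrow>
     (\<forall>x. 0 \<le> p x) \<and>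
     (\<forall>x. tautology x \<longrightarrow> p x = 1) \<and>
     (\<forall>x y. log_equiv x y \<longrightarrow> p x = p y) \<and>
     (\<forall>x y. contradiction (Con x y) \<longrightarrow> p (Dis x y) = p x + p y)"

text \<open>The second conjunct expresses the convention that \<open>C\<close> does not distinguish logically
  equivalent sentences. It is needed only for those \<open>a\<close> with \<open>C (Neg a) a = 1\<close>: there the
  remaining axioms alone would allow \<open>C (\<cdot>, a)\<close> to depend on the syntactic shape of sentences,
  so that neither constancy of \<open>C (\<cdot>, a)\<close> nor invariance in the second argument would follow.
  With it, both follow.\<close>

definition popper_function :: "('p fm \<Rightarrow> 'p fm \<Rightarrow> real) \<Rightarrow> bool" where
  "popper_function C \<longleftrightarrow>
     (\<forall>a b. 0 \<le> C a b \<and> C a b \<le> 1) \<and>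
     (\<forall>a b d. log_equiv a b \<longrightarrow> C a d = C b d) \<and>
     (\<forall>a. C a a = 1) \<and>
     (\<forall>a. C (Neg a) a \<noteq> 1 \<longrightarrow> prob_function (\<lambda>x. C x a)) \<and>
     (\<forall>a b d. C (Con a b) d = C a d * C b (Con a d)) \<and>
     (\<forall>a b. C a b = 1 \<and> C b a = 1 \<longrightarrow> (\<forall>d. C d a = C d b))"

definition regular :: "('p fm \<Rightarrow> 'p fm \<Rightarrow> real) \<Rightarrow> bool" where
  "regular C \<longleftrightarrow> (\<forall>x. (\<forall>y. C y x = 1) \<longrightarrow> contradiction x)"

text \<open>\<open>level C m b k = Some a\<close> means that the recursion reaches stage \<open>k\<close> and \<open>a\<^sub>k = a\<close>;
  \<open>None\<close> means that it has stopped before stage \<open>k\<close>.\<close>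

primrec level :: "('p fm \<Rightarrow> 'p fm \<Rightarrow> real) \<Rightarrow> nat \<Rightarrow> (nat \<Rightarrow> 'p fm) \<Rightarrow> nat \<Rightarrow> 'p fm option" where
  "level C m b 0 = Some (Disj b {1..m})"
| "level C m b (Suc k) =
     (case level C m b k of
        None \<Rightarrow> None
      | Some a \<Rightarrow>
          (let I = {i\<in>{1..m}. entails (b i) a \<and> C (b i) a = 0}
           in if I = {} then None else Some (Disj b I)))"

definition rk :: "('p fm \<Rightarrow> 'p fm \<Rightarrow> real) \<Rightarrow> nat \<Rightarrow> (nat \<Rightarrow> 'p fm) \<Rightarrow> nat \<Rightarrow> nat" where
  "rk C m b i = (LEAST k. \<exists>a. level C m b k = Some a \<and> C (b i) a > 0)"

definition interp :: "nat \<Rightarrow> (nat \<Rightarrow> 'p fm) \<Rightarrow> (nat \<Rightarrow> nat set) \<Rightarrow> 'p fm \<Rightarrow> nat set" where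
  "interp m b B x =
     (if contradiction x then {}
      else \<Union>{B i | i. \<exists>I\<subseteq>{1..m}. i \<in> I \<and> log_equiv x (Disj b I)})"

definition Lam :: "('p fm \<Rightarrow> 'p fm \<Rightarrow> real) \<Rightarrow> nat \<Rightarrow> (nat \<Rightarrow> 'p fm) \<Rightarrow> (nat \<Rightarrow> nat set) \<Rightarrow> nat set set" where
  "Lam C m b B = {l. finite l \<and>
     (\<forall>i\<in>{1..m}. \<forall>j\<in>{1..m}.
        (rk C m b i = rk C m b j \<longrightarrow> card (B i \<inter> l) = card (B j \<inter> l)) \<and>
        (rk C m b i < rk C m b j \<longrightarrow> card (B i \<inter> l) > (card (B j \<inter> l))\<^sup>2))}"

text \<open>An ultrafilter on a set \<open>L\<close> is represented by a filter on the ambient type that contains \<open>L\<close>;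
  its members are the sets \<open>{l. Q l}\<close> with \<open>eventually Q U\<close>.\<close>

definition ultrafilter_on :: "'i set \<Rightarrow> 'i filter \<Rightarrow> bool" where
  "ultrafilter_on L U \<longleftrightarrow>
     U \<noteq> bot \<and> eventually (\<lambda>l. l \<in> L) U \<and>
     (\<forall>Q. eventually Q U \<or> eventually (\<lambda>l. \<not> Q l) U)"

definition free_filter :: "'i filter \<Rightarrow> bool" where
  "free_filter U \<longleftrightarrow> (\<forall>x. eventually (\<lambda>l. l \<noteq> x) U)"

definition fine_filter :: "'a set filter \<Rightarrow> bool" where
  "fine_filter U \<longleftrightarrow> (\<forall>x. eventually (\<lambda>l. x \<in> l) U)"

text \<open>The ultrapower of the reals modulo \<open>U\<close>: its elements are the classes \<open>up_class U f\<close>.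
  As \<open>U\<close> contains the index set, the values of \<open>f\<close> outside that set are immaterial.\<close>

definition up_class :: "'i filter \<Rightarrow> ('i \<Rightarrow> real) \<Rightarrow> ('i \<Rightarrow> real) set" where
  "up_class U f = {g. eventually (\<lambda>l. f l = g l) U}"

definition up_map2 ::
  "'i filter \<Rightarrow> (real \<Rightarrow> real \<Rightarrow> real) \<Rightarrow> ('i \<Rightarrow> real) set \<Rightarrow> ('i \<Rightarrow> real) set \<Rightarrow> ('i \<Rightarrow> real) set" where
  "up_map2 U h X Y = (\<Union>f\<in>X. \<Union>g\<in>Y. up_class U (\<lambda>l. h (f l) (g l)))"

definition up_minus :: "'i filter \<Rightarrow> ('i \<Rightarrow> real) set \<Rightarrow> ('i \<Rightarrow> real) set \<Rightarrow> ('i \<Rightarrow> real) set" where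
  "up_minus U = up_map2 U (-)"

definition up_divide :: "'i filter \<Rightarrow> ('i \<Rightarrow> real) set \<Rightarrow> ('i \<Rightarrow> real) set \<Rightarrow> ('i \<Rightarrow> real) set" where
  "up_divide U = up_map2 U (/)"

definition up_abs :: "'i filter \<Rightarrow> ('i \<Rightarrow> real) set \<Rightarrow> ('i \<Rightarrow> real) set" where
  "up_abs U X = (\<Union>f\<in>X. up_class U (\<lambda>l. \<bar>f l\<bar>))"

definition up_less :: "'i filter \<Rightarrow> ('i \<Rightarrow> real) set \<Rightarrow> ('i \<Rightarrow> real) set \<Rightarrow> bool" where
  "up_less U X Y \<longleftrightarrow> (\<exists>f\<in>X. \<exists>g\<in>Y. eventually (\<lambda>l. f l < g l) U)"

definition up_real :: "'i filter \<Rightarrow> real \<Rightarrow> ('i \<Rightarrow> real) set" where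
  "up_real U r = up_class U (\<lambda>_. r)"

lemma up_map2_class:
  "up_map2 U h (up_class U f) (up_class U g) = up_class U (\<lambda>l. h (f l) (g l))"
proof (intro set_eqI iffI)
  fix k assume "k \<in> up_map2 U h (up_class U f) (up_class U g)"
  then obtain f' g' where "eventually (\<lambda>l. f l = f' l) U" "eventually (\<lambda>l. g l = g' l) U"
    "eventually (\<lambda>l. h (f' l) (g' l) = k l) U"
    by (auto simp: up_map2_def up_class_def)
  then have "eventually (\<lambda>l. h (f l) (g l) = k l) U"
    by eventually_elim simp
  then show "k \<in> up_class U (\<lambda>l. h (f l) (g l))"
    by (simp add: up_class_def)
qed (force simp: up_map2_def up_class_def)

lemma up_abs_class: "up_abs U (up_class U f) = up_class U (\<lambda>l. \<bar>f l\<bar>)"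
proof (intro set_eqI iffI)
  fix k assume "k \<in> up_abs U (up_class U f)"
  then obtain f' where "eventually (\<lambda>l. f l = f' l) U" "eventually (\<lambda>l. \<bar>f' l\<bar> = k l) U"
    by (auto simp: up_abs_def up_class_def)
  then have "eventually (\<lambda>l. \<bar>f l\<bar> = k l) U"
    by eventually_elim simp
  then show "k \<in> up_class U (\<lambda>l. \<bar>f l\<bar>)"
    by (simp add: up_class_def)
qed (force simp: up_abs_def up_class_def)

lemma up_less_class:
  "up_less U (up_class U f) (up_class U g) \<longleftrightarrow> eventually (\<lambda>l. f l < g l) U"
proof
  assume "up_less U (up_class U f) (up_class U g)"
  then obtain f' g' where "eventually (\<lambda>l. f l = f' l) U" "eventually (\<lambda>l. g l = g' l) U"
    "eventually (\<lambda>l. f' l < g' l) U"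
    by (auto simp: up_less_def up_class_def)
  then show "eventually (\<lambda>l. f l < g l) U"
    by eventually_elim simp
qed (force simp: up_less_def up_class_def)

definition infinitely_close :: "'i filter \<Rightarrow> ('i \<Rightarrow> real) set \<Rightarrow> ('i \<Rightarrow> real) set \<Rightarrow> bool" where
  "infinitely_close U X Y \<longleftrightarrow>
     (\<forall>e>0. up_less U (up_abs U (up_minus U X Y)) (up_real U e))"

definition st :: "'i filter \<Rightarrow> ('i \<Rightarrow> real) set \<Rightarrow> real" where
  "st U X = (THE r. infinitely_close U X (up_real U r))"

definition NAP :: "'a set filter \<Rightarrow> ('a \<Rightarrow> real) \<Rightarrow> 'a set \<Rightarrow> ('a set \<Rightarrow> real) set" where
  "NAP U w A = up_class U (\<lambda>l. (\<Sum>x\<in>A \<inter> l. w x) / (\<Sum>x\<in>l. w x))"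

end

theory Submission
  imports Defs
begin

text \<open>
  Let \<open>k\<close> be the least rank of an atom entailing \<open>y\<close>. Then \<open>y\<close> entails \<open>a\<^sub>k\<close> and \<open>C(y, a\<^sub>k) > 0\<close>, so
  axiom (3) gives \<open>C(x, y) = C(x \<and> y, a\<^sub>k) / C(y, a\<^sub>k)\<close>; by additivity only the atoms of rank exactly
  \<open>k\<close> contribute to numerator and denominator, each with its weight \<open>w\<close>. On the other side,
  for \<open>\<lambda> \<in> \<Lambda>\<close> all atoms of rank \<open>k\<close> have the same number \<open>N\<close> of points in \<open>\<lambda>\<close>, whereas an
  atom of higher rank has \<open>n\<close> points with \<open>n\<^sup>2 < N\<close>. Fineness makes \<open>n\<close> unbounded along the
  ultrafilter, so \<open>n / N < 1 / n\<close> is infinitesimal and the quotient of the two weighted counts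
  has the same standard part.

  The definition of normal atoms does not exclude contradictory \<open>b\<^sub>i\<close>. These all end up in the last
  stage of the recursion, hence are negligible against any atom that is not a contradiction.
\<close>

section \<open>Normal atoms\<close>

lemma sat_disj_list: "xs \<noteq> [] \<Longrightarrow> sat v (disj_list xs) \<longleftrightarrow> (\<exists>x\<in>set xs. sat v x)"
  by (induction xs rule: disj_list.induct) auto

lemma sat_Disj:
  assumes "finite I" "I \<noteq> {}"
  shows "sat v (Disj b I) \<longleftrightarrow> (\<exists>i\<in>I. sat v (b i))"
  using assms by (simp add: Disj_def sat_disj_list)

locale normal_atom_system =
  fixes m :: nat and b :: "nat \<Rightarrow> 'p fm"
  assumes normal: "normal_atoms m b"
begin

lemma atom_unique:
  assumes "i \<in> {1..m}" "j \<in> {1..m}" "sat v (b i)" "sat v (b j)"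
  shows "i = j"
  using normal assms unfolding normal_atoms_def contradiction_def by fastforce

lemma atom_exists: "\<exists>i\<in>{1..m}. sat v (b i)"
proof -
  have "1 \<le> m" and "sat v (Disj b {1..m})"
    using normal unfolding normal_atoms_def tautology_def by auto
  then show ?thesis
    using sat_Disj[of "{1..m}" v b] by auto
qed

text \<open>A disjunction of atoms equivalent to \<open>z\<close> has a disjunct true at
  \<open>v\<close>. By uniqueness that disjunct is \<open>b i\<close>, so a single valuation decides
  entailment by an atom.\<close>

lemma sat_imp_entails:
  assumes "i \<in> {1..m}" "sat v (b i)" "sat v z"
  shows "entails (b i) z"
proof -
  have "\<not> contradiction z"
    using assms by (auto simp: contradiction_def)
  then obtain I where I: "I \<subseteq> {1..m}" "I \<noteq> {}" "log_equiv z (Disj b I)"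
    using normal unfolding normal_atoms_def by blast
  then have sat_z: "sat u z \<longleftrightarrow> (\<exists>j\<in>I. sat u (b j))" for u
    using sat_Disj[of I u b] finite_subset[OF I(1)] by (simp add: log_equiv_def)
  then obtain j where "j \<in> I" "sat v (b j)"
    using assms by auto
  then have "i \<in> I"
    using atom_unique assms I(1) by blast
  then show ?thesis
    using sat_z by (auto simp: entails_def)
qed

text \<open>Contradictory atoms entail every sentence, so the case split is what leaves a
  contradiction without atoms, as in \<open>interp\<close>. For any other sentence this is the
  largest index set representing it.\<close>

definition atoms_of :: "'p fm \<Rightarrow> nat set" where
  "atoms_of z = (if contradiction z then {} else {i\<in>{1..m}. entails (b i) z})"

lemma atoms_of_subset: "atoms_of z \<subseteq> {1..m}"
  by (auto simp: atoms_of_def)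

lemma finite_atoms_of: "finite (atoms_of z)"
  using atoms_of_subset finite_subset by blast

lemma atoms_of_sat:
  assumes "sat v z"
  obtains i where "i \<in> atoms_of z" "sat v (b i)"
proof -
  obtain i where "i \<in> {1..m}" "sat v (b i)"
    using atom_exists by blast
  moreover from this have "i \<in> atoms_of z"
    using sat_imp_entails[of i v z] assms by (auto simp: atoms_of_def contradiction_def)
  ultimately show ?thesis
    using that by blast
qed

lemma atoms_of_nonempty: "\<not> contradiction z \<Longrightarrow> atoms_of z \<noteq> {}"
  using atoms_of_sat unfolding contradiction_def by blast

lemma log_equiv_atoms_of:
  assumes "\<not> contradiction z"
  shows "log_equiv z (Disj b (atoms_of z))"
proof -
  have "sat v z \<longleftrightarrow> (\<exists>i\<in>atoms_of z. sat v (b i))" for v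
    using atoms_of_sat[of v z] assms by (auto simp: atoms_of_def entails_def)
  then show ?thesis
    using atoms_of_nonempty[OF assms] by (simp add: log_equiv_def sat_Disj finite_atoms_of)
qed

text \<open>The index sets collected in \<open>interp\<close> can differ only in contradictory
  atoms. Each lies inside \<open>atoms_of z\<close>, which is itself one of them.\<close>

lemma interp_eq: "interp m b B z = (\<Union>i\<in>atoms_of z. B i)"
proof (cases "contradiction z")
  case False
  have "(\<exists>I\<subseteq>{1..m}. i \<in> I \<and> log_equiv z (Disj b I)) \<longleftrightarrow> i \<in> atoms_of z" for i
  proof
    assume "\<exists>I\<subseteq>{1..m}. i \<in> I \<and> log_equiv z (Disj b I)"
    then obtain I where I: "I \<subseteq> {1..m}" "i \<in> I" "log_equiv z (Disj b I)"
      by blast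
    then have "sat v z \<longleftrightarrow> (\<exists>j\<in>I. sat v (b j))" for v
      using sat_Disj[of I v b] finite_subset[OF I(1)] by (auto simp: log_equiv_def)
    with I False show "i \<in> atoms_of z"
      by (auto simp: atoms_of_def entails_def)
  qed (use log_equiv_atoms_of[OF False] atoms_of_subset in blast)
  with False show ?thesis
    by (auto simp: interp_def)
qed (simp add: interp_def atoms_of_def)

lemma prob_function_Disj:
  assumes p: "prob_function p" and I: "finite I" "I \<noteq> {}" "I \<subseteq> {1..m}"
  shows "p (Disj b I) = (\<Sum>i\<in>I. p (b i))"
  using I
proof (induction I rule: finite_ne_induct)
  case (singleton i)
  then show ?case by (simp add: Disj_def)
next
  case (insert i I)
  have "log_equiv (Disj b (insert i I)) (Dis (b i) (Disj b I))"
    using insert by (auto simp: log_equiv_def sat_Disj)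
  moreover have "contradiction (Con (b i) (Disj b I))"
  proof -
    have "\<not> (sat v (b i) \<and> (\<exists>j\<in>I. sat v (b j)))" for v
      using atom_unique[of i _ v] insert by blast
    then show ?thesis
      using insert by (simp add: contradiction_def sat_Disj)
  qed
  ultimately have "p (Disj b (insert i I)) = p (b i) + p (Disj b I)"
    using p unfolding prob_function_def by metis
  then show ?case
    using insert by simp
qed

text \<open>A contradiction is incompatible with itself, so additivity applies to the pair
  \<open>z\<close>, \<open>z\<close>.\<close>

lemma prob_function_contradiction:
  assumes "prob_function p" "contradiction z"
  shows "p z = 0"
proof -
  have "contradiction (Con z z)" "log_equiv z (Dis z z)"
    using assms by (auto simp: contradiction_def log_equiv_def)
  then have "p z = p z + p z"
    using assms(1) unfolding prob_function_def by metis
  then show ?thesis by simp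
qed

lemma prob_function_atoms_of:
  assumes "prob_function p"
  shows "p z = (\<Sum>i\<in>atoms_of z. p (b i))"
proof (cases "contradiction z")
  case True
  then show ?thesis
    using assms prob_function_contradiction by (simp add: atoms_of_def)
next
  case False
  then have "p z = p (Disj b (atoms_of z))"
    using log_equiv_atoms_of assms unfolding prob_function_def by blast
  then show ?thesis
    using prob_function_Disj[OF assms finite_atoms_of atoms_of_nonempty[OF False] atoms_of_subset]
    by simp
qed

end

section \<open>Stages and ranks of a regular Popper function\<close>

locale regular_popper = normal_atom_system m b
  for m :: nat and b :: "nat \<Rightarrow> 'p fm" +
  fixes C :: "'p fm \<Rightarrow> 'p fm \<Rightarrow> real"
  assumes popper: "popper_function C" and regular: "regular C"
begin

section \<open>Consequences of the Popper axioms and of regularity\<close>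

lemma C_nonneg: "0 \<le> C x y"
  and C_le_1: "C x y \<le> 1"
  and C_self: "C x x = 1"
  and C_Con: "C (Con x y) z = C x z * C y (Con x z)"
  using popper unfolding popper_function_def by blast+

lemma C_cong_left: "log_equiv x y \<Longrightarrow> C x z = C y z"
  using popper unfolding popper_function_def by blast

lemma C_cong_right:
  assumes "log_equiv x y"
  shows "C z x = C z y"
proof -
  have "log_equiv y x"
    using assms by (simp add: log_equiv_def)
  then have "C x y = 1" "C y x = 1"
    using assms C_cong_left C_self by metis+
  then show ?thesis
    using popper unfolding popper_function_def by blast
qed

text \<open>In axiom (3) for \<open>Con x y\<close> given \<open>x\<close>, both
  \<open>Con x y\<close> and \<open>Con x x\<close> are equivalent to \<open>x\<close>, which leaves
  \<open>C y x\<close> as the only factor that could differ from 1.\<close>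

lemma C_contradiction:
  assumes "contradiction x"
  shows "C y x = 1"
proof -
  have "log_equiv (Con x y) x" "log_equiv (Con x x) x"
    using assms by (auto simp: log_equiv_def contradiction_def)
  then show ?thesis
    using C_Con[of x y x] C_cong_left C_cong_right C_self by (metis mult_1)
qed

text \<open>If \<open>C (Neg x) x = 1\<close>, then a contradiction has value 1 given
  \<open>x\<close>, hence so does every sentence, and regularity makes \<open>x\<close> a
  contradiction.\<close>

lemma prob_function_C:
  assumes "\<not> contradiction x"
  shows "prob_function (\<lambda>y. C y x)"
proof (rule ccontr)
  assume "\<not> prob_function (\<lambda>y. C y x)"
  then have neg: "C (Neg x) x = 1"
    using popper unfolding popper_function_def by blast
  define bot where "bot = Con x (Neg x)"
  have "log_equiv (Con x x) x"
    by (simp add: log_equiv_def)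
  then have bot: "C bot x = 1"
    using C_Con[of x "Neg x" x] C_cong_right C_self neg unfolding bot_def by (metis mult_1)
  have "C y x = 1" for y
  proof -
    have "log_equiv (Con y bot) bot"
      by (auto simp: log_equiv_def bot_def)
    \<comment> \<open>A product of two numbers in [0,1] equals 1 only if both factors do.\<close>
    then have "C y x * C bot (Con y x) = 1"
      using bot C_cong_left C_Con by metis
    moreover have "C y x * C bot (Con y x) \<le> C y x"
      using C_nonneg C_le_1 by (simp add: mult_left_le)
    ultimately show ?thesis
      using C_le_1[of y x] by linarith
  qed
  then show False
    using regular assms unfolding regular_def by blast
qed

section \<open>Stages of the recursion as index sets\<close>

text \<open>The index set of the k-th stage of \<open>level\<close>. A recursion that has stopped
  becomes the empty set and stays empty, whatever value \<open>Disj b {}\<close> has.\<close>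

primrec stage :: "nat \<Rightarrow> nat set" where
  "stage 0 = {1..m}"
| "stage (Suc k) = {i\<in>stage k. C (b i) (Disj b (stage k)) = 0}"

abbreviation "stage_fm k \<equiv> Disj b (stage k)"

lemma stage_antimono: "j \<le> k \<Longrightarrow> stage k \<subseteq> stage j"
  by (rule lift_Suc_antimono_le) auto

lemma stage_subset: "stage k \<subseteq> {1..m}"
  using stage_antimono[of 0 k] by simp

lemma finite_stage: "finite (stage k)"
  using stage_subset finite_subset by blast

lemma sat_stage_fm: "stage k \<noteq> {} \<Longrightarrow> sat v (stage_fm k) \<longleftrightarrow> (\<exists>i\<in>stage k. sat v (b i))"
  using sat_Disj finite_stage by blast

text \<open>If stage \<open>Suc k\<close> is nonempty, some value given \<open>stage_fm k\<close> is
  0, so \<open>stage_fm k\<close> is not a contradiction. Contradictory atoms then have probability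
  0 and move on to the next stage.\<close>

lemma contradictory_atom_in_stage:
  assumes "stage k \<noteq> {}" "i \<in> {1..m}" "contradiction (b i)"
  shows "i \<in> stage k"
  using assms
proof (induction k)
  case (Suc k)
  then have "i \<in> stage k" and "\<not> contradiction (stage_fm k)"
    using C_contradiction by auto
  then show ?case
    using Suc prob_function_contradiction[OF prob_function_C] by simp
qed simp

lemma entails_stage_fm:
  assumes "stage k \<noteq> {}" "i \<in> {1..m}"
  shows "entails (b i) (stage_fm k) \<longleftrightarrow> i \<in> stage k"
proof
  assume ent: "entails (b i) (stage_fm k)"
  show "i \<in> stage k"
  proof (cases "contradiction (b i)")
    case True
    then show ?thesis
      using contradictory_atom_in_stage assms by blast
  next
    case False
    then obtain v where v: "sat v (b i)"
      by (auto simp: contradiction_def)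
    then obtain j where "j \<in> stage k" "sat v (b j)"
      using ent sat_stage_fm[OF assms(1)] by (auto simp: entails_def)
    then show ?thesis
      using atom_unique[of i j v] v assms(2) stage_subset by blast
  qed
qed (use sat_stage_fm[OF assms(1)] in \<open>auto simp: entails_def\<close>)

lemma level_eq: "level C m b k = (if stage k = {} then None else Some (stage_fm k))"
proof (induction k)
  case 0
  then show ?case
    using normal by (simp add: normal_atoms_def)
next
  case (Suc k)
  show ?case
  proof (cases "stage k = {}")
    case False
    have "{i\<in>{1..m}. entails (b i) (stage_fm k) \<and> C (b i) (stage_fm k) = 0} = stage (Suc k)"
      using entails_stage_fm[OF False] stage_subset[of k] by auto
    then show ?thesis
      using Suc False by (simp add: Let_def)
  qed (use Suc in simp)
qed

text \<open>Some atom must drop out: given a contradictory \<open>stage_fm k\<close> all values are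
  1, and otherwise the values over the stage add up to 1.\<close>

lemma stage_Suc_psubset:
  assumes "stage k \<noteq> {}"
  shows "stage (Suc k) \<subset> stage k"
proof -
  have "\<exists>i\<in>stage k. C (b i) (stage_fm k) \<noteq> 0"
  proof (cases "contradiction (stage_fm k)")
    case True
    then show ?thesis
      using assms C_contradiction by fastforce
  next
    case False
    have "(\<Sum>i\<in>stage k. C (b i) (stage_fm k)) = 1"
      using prob_function_Disj[OF prob_function_C[OF False] finite_stage assms stage_subset] C_self
      by simp
    then show ?thesis
      by (metis sum.neutral zero_neq_one)
  qed
  then show ?thesis by auto
qed

lemma stage_empty: "\<exists>k. stage k = {}"
proof -
  have "card (stage k) + k \<le> m \<or> stage k = {}" for k
  proof (induction k)
    case (Suc k)
    then show ?case
      using psubset_card_mono[OF finite_stage stage_Suc_psubset, of k] by fastforce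
  qed simp
  from this[of "Suc m"] have "stage (Suc m) = {}" by linarith
  then show ?thesis ..
qed

abbreviation "rank i \<equiv> rk C m b i"

text \<open>The rank is the last stage that still contains \<open>i\<close>: exactly there the value
  of \<open>b i\<close> is nonzero, since otherwise \<open>i\<close> would pass to the next
  stage.\<close>

lemma rank:
  assumes i: "i \<in> {1..m}"
  shows stage_rank: "i \<in> stage (rank i)"
    and C_stage_rank_pos: "0 < C (b i) (stage_fm (rank i))"
proof -
  define l where "l = (LEAST k. i \<notin> stage k)"
  have out: "i \<notin> stage l"
    unfolding l_def by (rule LeastI_ex) (metis stage_empty empty_iff)
  have before: "i \<in> stage k" if "k < l" for k
    using that not_less_Least unfolding l_def by blast
  obtain r where r: "l = Suc r"
    using out i by (cases l) auto
  have in_r: "i \<in> stage r"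
    using before r by simp
  then have pos: "0 < C (b i) (stage_fm r)"
    using out C_nonneg[of "b i" "stage_fm r"] by (simp add: r less_le)
  have "rank i = r"
    unfolding rk_def
  proof (rule Least_equality)
    show "\<exists>a. level C m b r = Some a \<and> 0 < C (b i) a"
      using in_r pos by (auto simp: level_eq)
  next
    fix k assume "\<exists>a. level C m b k = Some a \<and> 0 < C (b i) a"
    then have "0 < C (b i) (stage_fm k)"
      by (auto simp: level_eq split: if_splits)
    \<comment> \<open>The definition of \<open>rk\<close> does not ask that \<open>i\<close> lie in
      the stage; a positive value alone already excludes \<open>i\<close> from stage
      \<open>Suc k\<close>, hence \<open>l \<le> Suc k\<close>.\<close>
    then have "i \<notin> stage (Suc k)" by simp
    then show "r \<le> k"
      using before[of "Suc k"] r by linarith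
  qed
  then show "i \<in> stage (rank i)" "0 < C (b i) (stage_fm (rank i))"
    using in_r pos by auto
qed

definition weight :: "nat \<Rightarrow> real" where
  "weight i = C (b i) (stage_fm (rank i))"

lemma weight_pos: "i \<in> {1..m} \<Longrightarrow> 0 < weight i"
  by (simp add: weight_def C_stage_rank_pos)

lemma the_level_rank: "i \<in> {1..m} \<Longrightarrow> C (b i) (the (level C m b (rank i))) = weight i"
  using stage_rank by (auto simp: level_eq weight_def)

section \<open>Conditional values from the atoms of least rank\<close>

definition top_atoms :: "'p fm \<Rightarrow> nat set" where
  "top_atoms y = {i\<in>atoms_of y. \<forall>j\<in>atoms_of y. rank i \<le> rank j}"

lemma top_atoms_subset: "top_atoms y \<subseteq> atoms_of y"
  by (auto simp: top_atoms_def)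

lemma rank_top_atoms: "i \<in> top_atoms y \<Longrightarrow> j \<in> atoms_of y \<Longrightarrow> rank i \<le> rank j"
  by (simp add: top_atoms_def)

lemma top_atoms_in_range: "i \<in> top_atoms y \<Longrightarrow> i \<in> {1..m}"
  using top_atoms_subset atoms_of_subset by blast

lemma rank_top_atoms_less:
  assumes "i \<in> top_atoms y" "j \<in> atoms_of y - top_atoms y"
  shows "rank i < rank j"
proof -
  obtain k where "k \<in> atoms_of y" "rank k < rank j"
    using assms(2) by (auto simp: top_atoms_def not_le)
  then show ?thesis
    using rank_top_atoms[OF assms(1)] le_less_trans by blast
qed

lemma top_atoms_nonempty:
  assumes "\<not> contradiction y"
  shows "top_atoms y \<noteq> {}"
  using arg_min_if_finite[OF finite_atoms_of atoms_of_nonempty[OF assms], of rank]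
  by (fastforce simp: top_atoms_def not_less)

lemma sum_weight_top_atoms_pos:
  assumes "\<not> contradiction y"
  shows "0 < sum weight (top_atoms y)"
  using top_atoms_nonempty[OF assms] top_atoms_subset[of y] atoms_of_subset[of y]
    finite_atoms_of[of y] weight_pos
  by (intro sum_pos) (auto intro: finite_subset)

lemma C_eq_top_atoms:
  assumes y: "\<not> contradiction y"
  shows "C x y = sum weight (top_atoms y \<inter> atoms_of x) / sum weight (top_atoms y)"
proof -
  obtain i0 where i0: "i0 \<in> top_atoms y"
    using top_atoms_nonempty[OF y] by blast
  define k where "k = rank i0"
  define a where "a = stage_fm k"
  have rank_ge: "k \<le> rank i" if "i \<in> atoms_of y" for i
    using i0 that by (simp add: top_atoms_def k_def)
  have top_iff: "i \<in> top_atoms y \<longleftrightarrow> i \<in> atoms_of y \<and> rank i = k" for i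
    using i0 by (force simp: top_atoms_def k_def intro: antisym)
  \<comment> \<open>Stages decrease, so an atom of rank at least \<open>k\<close> is still present
    at stage \<open>k\<close>.\<close>
  have in_stage: "i \<in> stage k" if "i \<in> atoms_of y" for i
    using stage_rank[of i] stage_antimono[OF rank_ge[OF that]] atoms_of_subset that by blast
  have nonempty: "stage k \<noteq> {}"
    using in_stage top_iff i0 by blast
  have "entails y a"
    unfolding entails_def a_def sat_stage_fm[OF nonempty]
    using in_stage atoms_of_sat by metis
  then have a: "\<not> contradiction a" and y_a: "log_equiv (Con y a) y"
    using y by (auto simp: entails_def contradiction_def log_equiv_def)
  note prob = prob_function_C[OF a]
  have C_atom: "C (b i) a = (if i \<in> top_atoms y then weight i else 0)" if "i \<in> atoms_of y" for i
  proof (cases "rank i = k")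
    case True
    then show ?thesis
      using that by (simp add: top_iff weight_def a_def)
  next
    case False
    then have "Suc k \<le> rank i"
      using rank_ge[OF that] by simp
    \<comment> \<open>Surviving into stage \<open>Suc k\<close> means, by definition of the stages,
      having value 0 given \<open>a\<close>.\<close>
    then have "i \<in> stage (Suc k)"
      using stage_antimono stage_rank[of i] that atoms_of_subset by blast
    then show ?thesis
      using False by (simp add: top_iff a_def)
  qed
  have C_sum: "C z a = sum weight (top_atoms y \<inter> atoms_of z)"
    if "atoms_of z \<subseteq> atoms_of y" for z
  proof -
    have "C z a = (\<Sum>i\<in>atoms_of z. C (b i) a)"
      using prob_function_atoms_of[OF prob] .
    also have "\<dots> = (\<Sum>i\<in>atoms_of z. if i \<in> top_atoms y then weight i else 0)"
      using that C_atom by (intro sum.cong) auto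
    also have "\<dots> = sum weight (top_atoms y \<inter> atoms_of z)"
      using finite_atoms_of by (simp add: sum.If_cases Int_commute)
    finally show ?thesis .
  qed
  \<comment> \<open>The two sets of atoms could differ on contradictory atoms when
    \<open>Con y x\<close> is a contradiction but \<open>x\<close> is not. Top atoms have positive
    value given \<open>a\<close> and so are never contradictory.\<close>
  have "top_atoms y \<inter> atoms_of (Con y x) = top_atoms y \<inter> atoms_of x"
  proof -
    have "\<not> contradiction (b i)" if "i \<in> top_atoms y" for i
    proof
      assume "contradiction (b i)"
      then have "C (b i) a = 0"
        using prob_function_contradiction[OF prob] by blast
      then show False
        using C_atom[of i] weight_pos[of i] that top_atoms_subset atoms_of_subset by fastforce
    qed
    then have "i \<in> atoms_of (Con y x) \<longleftrightarrow> i \<in> atoms_of x" if "i \<in> top_atoms y" for i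
      using that top_atoms_subset[of y] y
      by (fastforce simp: atoms_of_def contradiction_def entails_def split: if_splits)
    then show ?thesis by auto
  qed
  moreover have "atoms_of (Con y x) \<subseteq> atoms_of y"
    by (auto simp: atoms_of_def contradiction_def entails_def)
  ultimately have "C (Con y x) a = sum weight (top_atoms y \<inter> atoms_of x)"
    using C_sum by simp
  moreover have "C y a = sum weight (top_atoms y)"
    using C_sum[of y] top_atoms_subset by (simp add: Int_absorb2)
  \<comment> \<open>Axiom (3), with \<open>Con y a\<close> replaced by the equivalent
    \<open>y\<close>.\<close>
  moreover have "C (Con y x) a = C y a * C x y"
    using C_Con C_cong_right[OF y_a] by simp
  ultimately show ?thesis
    using sum_weight_top_atoms_pos[OF y] by (simp add: field_simps)
qed

end

section \<open>Standard parts as limits along the ultrafilter\<close>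

text \<open>Unfolded on representatives, infinite closeness says that each bound
  \<open>e > 0\<close> holds eventually. Standard parts can therefore be computed as limits along
  the filter.\<close>

lemma infinitely_close_up_real_iff_tendsto:
  "infinitely_close U (up_class U f) (up_real U r) \<longleftrightarrow> (f \<longlongrightarrow> r) U"
  by (simp add: infinitely_close_def up_real_def up_minus_def up_map2_class up_abs_class
      up_less_class tendsto_iff dist_real_def)

lemma st_eqI:
  assumes "U \<noteq> bot" "(f \<longlongrightarrow> r) U"
  shows "st U (up_class U f) = r"
  unfolding st_def infinitely_close_up_real_iff_tendsto
  using assms tendsto_unique by blast

text \<open>Dividing numerator and denominator by \<open>N\<close> turns each count into a ratio
  that tends to 1 on \<open>T\<close> and to 0 on \<open>J - T\<close>, so only the weights over
  \<open>T\<close> survive.\<close>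

lemma tendsto_weighted_quotient:
  fixes n :: "'i \<Rightarrow> 'a \<Rightarrow> real" and u :: "'i \<Rightarrow> real"
  assumes "finite J" "T \<subseteq> J" "sum u T \<noteq> 0"
    and N: "eventually (\<lambda>l. N l \<noteq> 0) F"
    and top: "\<And>i. i \<in> T \<Longrightarrow> eventually (\<lambda>l. n i l = N l) F"
    and small: "\<And>i. i \<in> J - T \<Longrightarrow> ((\<lambda>l. n i l / N l) \<longlongrightarrow> 0) F"
  shows "((\<lambda>l. (\<Sum>i\<in>K \<inter> J. u i * n i l) / (\<Sum>i\<in>J. u i * n i l))
           \<longlongrightarrow> sum u (T \<inter> K) / sum u T) F"
proof -
  have ratio: "((\<lambda>l. n i l / N l) \<longlongrightarrow> (if i \<in> T then 1 else 0)) F" if "i \<in> J" for i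
  proof (cases "i \<in> T")
    case True
    have "eventually (\<lambda>l. n i l / N l = 1) F"
      using N top[OF True] by eventually_elim simp
    then show ?thesis
      using True by (simp add: tendsto_eventually)
  qed (use small that in simp)
  have lim: "((\<lambda>l. (\<Sum>i\<in>I. u i * n i l) / N l) \<longlongrightarrow> sum u (T \<inter> I)) F" if "I \<subseteq> J" for I
  proof -
    have "((\<lambda>l. \<Sum>i\<in>I. u i * (n i l / N l)) \<longlongrightarrow> (\<Sum>i\<in>I. u i * (if i \<in> T then 1 else 0))) F"
      using that by (intro tendsto_sum tendsto_mult tendsto_const ratio) auto
    moreover have "(\<Sum>i\<in>I. u i * (if i \<in> T then 1 else 0)) = sum u (T \<inter> I)"
      using finite_subset[OF that assms(1)]
      by (simp add: if_distrib sum.If_cases Int_commute cong: if_cong)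
    ultimately show ?thesis
      by (simp add: sum_divide_distrib)
  qed
  have "T \<inter> (K \<inter> J) = T \<inter> K" "T \<inter> J = T"
    using assms(2) by auto
  then have "((\<lambda>l. ((\<Sum>i\<in>K \<inter> J. u i * n i l) / N l) / ((\<Sum>i\<in>J. u i * n i l) / N l))
      \<longlongrightarrow> sum u (T \<inter> K) / sum u T) F"
    using tendsto_divide[OF lim[of "K \<inter> J"] lim[of J]] assms(3) by simp
  moreover have "eventually (\<lambda>l. ((\<Sum>i\<in>K \<inter> J. u i * n i l) / N l) / ((\<Sum>i\<in>J. u i * n i l) / N l)
      = (\<Sum>i\<in>K \<inter> J. u i * n i l) / (\<Sum>i\<in>J. u i * n i l)) F"
    using N by eventually_elim simp
  ultimately show ?thesis
    by (rule Lim_transform_eventually)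
qed

lemma fine_filter_eventually_subset:
  assumes "fine_filter U" "finite S"
  shows "eventually (\<lambda>l. S \<subseteq> l) U"
proof -
  have "eventually (\<lambda>l. \<forall>s\<in>S. s \<in> l) U"
    using assms by (simp add: eventually_ball_finite fine_filter_def)
  then show ?thesis
    by (simp add: subset_eq)
qed

text \<open>\<open>A\<close> has finite subsets of every size, and fineness puts each of them
  eventually inside \<open>l\<close>. Finiteness of \<open>l\<close> keeps \<open>card\<close> from
  defaulting to 0.\<close>

lemma fine_filter_card_at_top:
  assumes "fine_filter U" "infinite A" "eventually finite U"
  shows "filterlim (\<lambda>l. real (card (A \<inter> l))) at_top U"
proof -
  have "eventually (\<lambda>l. k \<le> card (A \<inter> l)) U" for k
  proof -
    obtain S where S: "finite S" "card S = k" "S \<subseteq> A"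
      using infinite_arbitrarily_large[OF assms(2)] by blast
    show ?thesis
      using fine_filter_eventually_subset[OF assms(1) S(1)] assms(3)
    proof eventually_elim
      case (elim l)
      then show ?case
        using S card_mono[of "A \<inter> l" S] by simp
    qed
  qed
  then have "filterlim (\<lambda>l. card (A \<inter> l)) at_top U"
    by (simp add: filterlim_at_top)
  then show ?thesis
    by (rule filterlim_compose[OF filterlim_real_sequentially])
qed

section \<open>Weighted counts along the ultrafilter\<close>

theorem theorem3:
  fixes C :: "'p::finite fm \<Rightarrow> 'p fm \<Rightarrow> real"
    and m :: nat
    and b :: "nat \<Rightarrow> 'p fm"
    and B :: "nat \<Rightarrow> nat set"
    and w :: "nat \<Rightarrow> real"
    and U :: "nat set filter"
    and x y :: "'p fm"
  assumes "normal_atoms m b"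
    and "popper_function C" and "regular C"
    and "disjoint_family_on B {1..m}"
    and "\<And>i. i \<in> {1..m} \<Longrightarrow> infinite (B i)"
    and "(\<Union>i\<in>{1..m}. B i) = UNIV"
    and "\<And>i n. i \<in> {1..m} \<Longrightarrow> n \<in> B i \<Longrightarrow> w n = C (b i) (the (level C m b (rk C m b i)))"
    and "ultrafilter_on (Lam C m b B) U" and "free_filter U" and "fine_filter U"
    and "\<not> contradiction y"
  shows "C x y = st U (up_divide U (NAP U w (interp m b B x \<inter> interp m b B y))
                                   (NAP U w (interp m b B y)))"
proof -
  interpret regular_popper m b C
    using assms by unfold_locales
  define n where "n i l = real (card (B i \<inter> l))" for i l
  have Lam: "eventually (\<lambda>l. l \<in> Lam C m b B) U" and "U \<noteq> bot"
    using assms(8) by (auto simp: ultrafilter_on_def)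
  have fin: "eventually finite U"
    using Lam by eventually_elim (simp add: Lam_def)
  have n_top: "filterlim (n i) at_top U" if "i \<in> {1..m}" for i
    using fine_filter_card_at_top[OF assms(10) assms(5)[OF that] fin] by (simp add: n_def[abs_def])
  have n_pos: "eventually (\<lambda>l. 0 < n i l) U" if "i \<in> {1..m}" for i
    using n_top[OF that] by (simp add: filterlim_at_top_dense)
  have sum_w: "(\<Sum>s\<in>(\<Union>i\<in>I. B i) \<inter> l. w s) = (\<Sum>i\<in>I. weight i * n i l)"
    if "I \<subseteq> {1..m}" "finite l" for I l
  proof -
    have "(\<Sum>s\<in>(\<Union>i\<in>I. B i) \<inter> l. w s) = (\<Sum>s\<in>(\<Union>i\<in>I. B i \<inter> l). w s)"
      by (simp add: Int_UN_distrib2)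
    also have "\<dots> = (\<Sum>i\<in>I. \<Sum>s\<in>B i \<inter> l. w s)"
    proof (rule sum.UNION_disjoint)
      show "finite I"
        using that(1) by (rule finite_subset) simp
      show "\<forall>i\<in>I. finite (B i \<inter> l)"
        using that(2) by simp
      show "\<forall>i\<in>I. \<forall>j\<in>I. i \<noteq> j \<longrightarrow> B i \<inter> l \<inter> (B j \<inter> l) = {}"
        using that(1) assms(4) unfolding disjoint_family_on_def by blast
    qed
    also have "\<dots> = (\<Sum>i\<in>I. \<Sum>s\<in>B i \<inter> l. weight i)"
    proof (intro sum.cong refl)
      fix i s assume "i \<in> I" "s \<in> B i \<inter> l"
      then show "w s = weight i"
        using assms(7)[of i s] the_level_rank[of i] that(1) by (simp add: subset_iff)
    qed
    finally show ?thesis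
      by (simp add: n_def mult.commute)
  qed
  have inter: "interp m b B x \<inter> interp m b B y = (\<Union>i\<in>atoms_of x \<inter> atoms_of y. B i)"
  proof -
    \<comment> \<open>The blocks are pairwise disjoint, so a common point forces equal
      indices.\<close>
    have "s \<in> (\<Union>i\<in>atoms_of x \<inter> atoms_of y. B i)"
      if s: "s \<in> B i" "s \<in> B j" and ij: "i \<in> atoms_of x" "j \<in> atoms_of y" for s i j
    proof -
      have "i = j"
      proof (rule ccontr)
        assume "i \<noteq> j"
        with ij have "B i \<inter> B j = {}"
          by (intro disjoint_family_onD[OF assms(4)] subsetD[OF atoms_of_subset])
        with s show False by auto
      qed
      with s ij show ?thesis by auto
    qed
    then have "(\<Union>i\<in>atoms_of x. B i) \<inter> (\<Union>i\<in>atoms_of y. B i)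
        \<subseteq> (\<Union>i\<in>atoms_of x \<inter> atoms_of y. B i)"
      by (intro subsetI) (elim IntE UN_E)
    then show ?thesis
      unfolding interp_eq by (intro equalityI) auto
  qed
  \<comment> \<open>The count of this one atom serves as the common scale \<open>N\<close>.\<close>
  obtain i0 where i0: "i0 \<in> top_atoms y"
    using top_atoms_nonempty assms(11) by blast
  note i0_m = top_atoms_in_range[OF i0]
  have lim: "((\<lambda>l. (\<Sum>i\<in>atoms_of x \<inter> atoms_of y. weight i * n i l)
        / (\<Sum>i\<in>atoms_of y. weight i * n i l)) \<longlongrightarrow> C x y) U"
    unfolding C_eq_top_atoms[OF assms(11), of x]
  proof (rule tendsto_weighted_quotient[where N = "n i0", OF finite_atoms_of top_atoms_subset])
    show "sum weight (top_atoms y) \<noteq> 0"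
      using sum_weight_top_atoms_pos[OF assms(11)] by simp
    show "eventually (\<lambda>l. n i0 l \<noteq> 0) U"
      using n_pos[OF i0_m] by eventually_elim simp
  next
    fix i assume i: "i \<in> top_atoms y"
    then have "i \<in> atoms_of y" "i0 \<in> atoms_of y"
      using i0 top_atoms_subset by blast+
    then have "rank i = rank i0"
      using rank_top_atoms[OF i] rank_top_atoms[OF i0] by (simp add: antisym)
    show "eventually (\<lambda>l. n i l = n i0 l) U"
      using Lam
    proof eventually_elim
      case (elim l)
      then have "card (B i \<inter> l) = card (B i0 \<inter> l)"
        using \<open>rank i = rank i0\<close> top_atoms_in_range[OF i] i0_m unfolding Lam_def by blast
      then show ?case
        by (simp add: n_def)
    qed
  next
    fix i assume i: "i \<in> atoms_of y - top_atoms y"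
    have rank_less: "rank i0 < rank i"
      using rank_top_atoms_less[OF i0 i] .
    have i_m: "i \<in> {1..m}"
      using i atoms_of_subset[of y] by blast
    \<comment> \<open>Condition (ii) of \<open>Lam\<close> gives
      \<open>n i l * n i l \<le> n i0 l\<close>, so the ratio is at most the inverse of
      \<open>n i l\<close>, which tends to 0.\<close>
    have "eventually (\<lambda>l. norm (n i l / n i0 l) \<le> norm (inverse (n i l)) * 1) U"
      using Lam n_pos[OF i_m] n_pos[OF i0_m]
    proof eventually_elim
      case (elim l)
      then have "(card (B i \<inter> l))\<^sup>2 < card (B i0 \<inter> l)"
        using rank_less i_m i0_m unfolding Lam_def by blast
      then have "n i l * n i l \<le> n i0 l"
        unfolding n_def power2_eq_square of_nat_mult[symmetric] of_nat_le_iff by linarith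
      then show ?case
        using elim by (simp add: field_simps)
    qed
    then show "((\<lambda>l. n i l / n i0 l) \<longlongrightarrow> 0) U"
      by (rule tendsto_0_le[OF tendsto_inverse_0_at_top[OF n_top[OF i_m]]])
  qed
  \<comment> \<open>Both \<open>NAP\<close> values are normalised by this sum; it must be nonzero to
    cancel from their quotient.\<close>
  have total_pos: "eventually (\<lambda>l. (\<Sum>s\<in>l. w s) \<noteq> 0) U"
    using fin n_pos[OF i0_m]
  proof eventually_elim
    case (elim l)
    have "(\<Sum>s\<in>l. w s) = (\<Sum>i\<in>{1..m}. weight i * n i l)"
      using sum_w[of "{1..m}" l] elim assms(6) by simp
    also have "\<dots> > 0"
      using elim i0_m weight_pos
      by (intro sum_pos2[of _ i0]) (auto simp: n_def less_imp_le)
    finally show ?case by simp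
  qed
  let ?N = "\<lambda>A l. (\<Sum>s\<in>A \<inter> l. w s) / (\<Sum>s\<in>l. w s)"
  let ?q = "\<lambda>l. ?N (interp m b B x \<inter> interp m b B y) l / ?N (interp m b B y) l"
  have "eventually (\<lambda>l. (\<Sum>i\<in>atoms_of x \<inter> atoms_of y. weight i * n i l)
        / (\<Sum>i\<in>atoms_of y. weight i * n i l) = ?q l) U"
    using fin total_pos
  proof eventually_elim
    case (elim l)
    then show ?case
      unfolding inter unfolding interp_eq
      using sum_w[of "atoms_of x \<inter> atoms_of y" l] sum_w[of "atoms_of y" l] atoms_of_subset[of y]
      by (simp add: le_infI2)
  qed
  with lim have "(?q \<longlongrightarrow> C x y) U"
    by (rule Lim_transform_eventually)
  then show ?thesis
    using st_eqI[OF \<open>U \<noteq> bot\<close>] by (simp add: NAP_def up_divide_def up_map2_class)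
qed

end
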